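(* Let $z\in\mathbb{C}\setminus\{-\alpha\}$ be such that $k(z)\ne0$, and let $\rho,\nu\in\mathbb{C}$ with $\rho,\nu\ne0$ be such that $P_z(\rho,\nu)=0$, where $$P_z(\rho,\nu)=-(z+\alpha)(k^2(z)-\rho^2)(k^2(z)-\nu^2)+4c(z)k^2(z).$$ 1. If $k(z)\cosh(\rho a)+\rho\sinh(\rho a)=k(z)\cosh(\nu b)+\nu\sinh(\nu b)=0$, then $z$ is an eigenvalue with the eigenvector $q(x,y)=\cosh(\rho x)\cosh(\nu y)$. 2. If $k(z)\sinh(\rho a)+\rho\cosh(\rho a)=k(z)\cosh(\nu b)+\nu\sinh(\nu b)=0$, then $z$ is an eigenvalue with the eigenvector $q(x,y)=\sinh(\rho x)\cosh(\nu y)$. 3. If $k(z)\cosh(\rho a)+\rho\sinh(\rho a)=k(z)\sinh(\nu b)+\nu\cosh(\nu b)=0$, then $z$ is an eigenvalue with the eigenvector $q(x,y)=\cosh(\rho x)\sinh(\nu y)$. 4. If $k(z)\sinh(\rho a)+\rho\cosh(\rho a)=k(z)\sinh(\nu b)+\nu\cosh(\nu b)=0$, then $z$ is an eigenvalue with the eigenvector $q(x,y)=\sinh(\rho x)\sinh(\nu y)$.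
   Context: Fix $a,b>0$, $\bar\Omega=[-a,a]\times[-b,b]$ with interior $\Omega$, and write $r=(x,y)\in\bar\Omega$, $\|r\|_1=|x|+|y|$. Let $Y=C(\bar\Omega)$ (continuous complex-valued functions). Fix reals $\alpha>0$, $\tau_0>0$, $S'(0)\ne0$ and complex numbers $\hat c\ne0$, $\xi$ such that $J(r,r')=\hat ce^{-\xi\|r-r'\|_1}$ is real-valued. For $z\in\mathbb{C}$ put $k(z)=z+\xi$, $c(z)=\hat cS'(0)e^{-\tau_0z}$, and $$(\Delta(z)q)(r)=(z+\alpha)q(r)-c(z)\int_\Omega e^{-k(z)\|r-r'\|_1}q(r')\,dr',\quad q\in Y.$$ "$z$ is an eigenvalue with the eigenvector $q$" means that $q\in Y$ is nonzero and $\Delta(z)q=0$. Equivalently, $\varphi(t)(r)=e^{zt}q(r)$ is an eigenvector with eigenvalue $z$ of the operator $A\varphi=\varphi'$ on $X=C([-\tau_{max},0];Y)$, $\tau_{max}=\tau_0+2a+2b$, with domain $D(A)=\{\varphi\in X:\varphi'\in X,\ \varphi'(0)=-\alpha\varphi(0)+DG(0)\varphi\}$, where $(DG(0)\varphi)(r)=S'(0)\int_\Omega J(r,r')\varphi(-\tau_0-\|r-r'\|_1,r')\,dr'$. *)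

theory Defs
  imports "HOL-Analysis.Analysis"
begin

definition Omega_bar :: "real \<Rightarrow> real \<Rightarrow> (real \<times> real) set" where
  "Omega_bar a b = {-a..a} \<times> {-b..b}"

definition Omega :: "real \<Rightarrow> real \<Rightarrow> (real \<times> real) set" where
  "Omega a b = interior (Omega_bar a b)"

definition norm1 :: "real \<times> real \<Rightarrow> real" where
  "norm1 r = \<bar>fst r\<bar> + \<bar>snd r\<bar>"

text \<open>The space \<open>C(\<Omega>_bar)\<close>. Its elements are represented by total functions, of which
  only the values on the closed rectangle matter.\<close>

definition Y_space :: "real \<Rightarrow> real \<Rightarrow> (real \<times> real \<Rightarrow> complex) set" where
  "Y_space a b = {q. continuous_on (Omega_bar a b) q}"

definition J_ker :: "complex \<Rightarrow> complex \<Rightarrow> real \<times> real \<Rightarrow> real \<times> real \<Rightarrow> complex" where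
  "J_ker chat xi r r' = chat * exp (- xi * of_real (norm1 (r - r')))"

definition k_fun :: "complex \<Rightarrow> complex \<Rightarrow> complex" where
  "k_fun xi z = z + xi"

text \<open>The real parameter \<open>dS0\<close> stands for the number \<open>S'(0)\<close>; nothing else about the
  activation function \<open>S\<close> enters the linearised problem.\<close>

definition c_fun :: "real \<Rightarrow> real \<Rightarrow> complex \<Rightarrow> complex \<Rightarrow> complex" where
  "c_fun tau0 dS0 chat z = chat * of_real dS0 * exp (- of_real tau0 * z)"

definition Delta ::
  "real \<Rightarrow> real \<Rightarrow> real \<Rightarrow> real \<Rightarrow> real \<Rightarrow> complex \<Rightarrow> complex \<Rightarrow> complex
    \<Rightarrow> (real \<times> real \<Rightarrow> complex) \<Rightarrow> real \<times> real \<Rightarrow> complex" where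
  "Delta a b alpha tau0 dS0 chat xi z q r =
     (z + of_real alpha) * q r
     - c_fun tau0 dS0 chat z *
       (LINT r':Omega a b|lborel. exp (- k_fun xi z * of_real (norm1 (r - r'))) * q r')"

text \<open>\<open>z\<close> is an eigenvalue with the eigenvector \<open>q\<close>. Both \<open>q \<noteq> 0\<close> and \<open>\<Delta>(z) q = 0\<close> are
  statements in \<open>C(\<Omega>_bar)\<close>, hence about values on the closed rectangle.\<close>

definition eigenvalue_with_eigenvector ::
  "real \<Rightarrow> real \<Rightarrow> real \<Rightarrow> real \<Rightarrow> real \<Rightarrow> complex \<Rightarrow> complex \<Rightarrow> complex
    \<Rightarrow> (real \<times> real \<Rightarrow> complex) \<Rightarrow> bool" where
  "eigenvalue_with_eigenvector a b alpha tau0 dS0 chat xi z q \<longleftrightarrow>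
     q \<in> Y_space a b \<and>
     (\<exists>r\<in>Omega_bar a b. q r \<noteq> 0) \<and>
     (\<forall>r\<in>Omega_bar a b. Delta a b alpha tau0 dS0 chat xi z q r = 0)"

definition P_char ::
  "real \<Rightarrow> real \<Rightarrow> real \<Rightarrow> complex \<Rightarrow> complex \<Rightarrow> complex \<Rightarrow> complex \<Rightarrow> complex \<Rightarrow> complex" where
  "P_char alpha tau0 dS0 chat xi z \<rho> \<nu> =
     - (z + of_real alpha) * ((k_fun xi z)\<^sup>2 - \<rho>\<^sup>2) * ((k_fun xi z)\<^sup>2 - \<nu>\<^sup>2)
     + 4 * c_fun tau0 dS0 chat z * (k_fun xi z)\<^sup>2"

end

theory Submission
  imports Defs
begin

text \<open>
  The kernel \<open>exp (- k * norm1 (r - r'))\<close> is a product of a function of the first and a function of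
  the second coordinates, and so are the four candidate eigenvectors. Hence the integral in
  \<open>Delta\<close> is a product of two one-dimensional integrals
  (\<open>set_integral_open_rectangle_product\<close>).

  Let \<open>u\<close> be \<open>cosh (\<rho> x)\<close> or \<open>sinh (\<rho> x)\<close>, so that \<open>u'' = \<rho>\<^sup>2 u\<close>. On each side of the kink at
  \<open>x\<close> the function \<open>exp (- k \<bar>x - s\<bar>) u(s)\<close> has, up to the factor \<open>k\<^sup>2 - \<rho>\<^sup>2\<close>, an explicit
  antiderivative that involves \<open>k u - u'\<close> on the left and \<open>k u + u'\<close> on the right. The equations
  imposed on \<open>\<rho>\<close> say exactly that these expressions vanish at the ends of \<open>[-a, a]\<close>: only the
  contributions at \<open>x\<close> survive, and they add up to \<open>2 k u(x)\<close>
  (\<open>set_integral_exp_kernel\<close>). The same applies to the second coordinate with \<open>\<nu>\<close>. Therefore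
  \<open>(k\<^sup>2 - \<rho>\<^sup>2) (k\<^sup>2 - \<nu>\<^sup>2)\<close> times the double integral equals \<open>4 k\<^sup>2 q\<close>, and the equation
  \<open>\<Delta>(z) q = 0\<close> reduces to \<open>P_z(\<rho>, \<nu>) = 0\<close>. The factors \<open>k\<^sup>2 - \<rho>\<^sup>2\<close> and \<open>k\<^sup>2 - \<nu>\<^sup>2\<close> can be
  cancelled, because \<open>P_z(\<rho>, \<nu>) = 0\<close> says that their product times \<open>z + \<alpha>\<close> equals
  \<open>4 c k\<^sup>2\<close>, which is not zero.
\<close>

lemma set_integral_open_rectangle_product:
  fixes f g :: "real \<Rightarrow> complex"
  assumes f: "continuous_on {a..b} f" and g: "continuous_on {c..d} g"
  shows "(LINT p:{a<..<b} \<times> {c<..<d}|lborel. f (fst p) * g (snd p))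
       = (LINT s:{a<..<b}|lborel. f s) * (LINT t:{c<..<d}|lborel. g t)"
proof -
  let ?R = "{a<..<b} \<times> {c<..<d}"
  let ?h = "\<lambda>p. indicator ?R p *\<^sub>R (f (fst p) * g (snd p))"
  have "continuous_on ({a..b} \<times> {c..d}) (\<lambda>p. f (fst p) * g (snd p))"
    by (intro continuous_on_mult continuous_on_compose2[OF f] continuous_on_compose2[OF g]
          continuous_on_fst continuous_on_snd continuous_on_id) auto
  then have "set_integrable lborel ({a..b} \<times> {c..d}) (\<lambda>p. f (fst p) * g (snd p))"
    unfolding set_integrable_def
    by (intro borel_integrable_compact compact_Times) auto
  moreover have "?R \<in> sets lborel"
    by (auto intro!: borel_open open_Times)
  ultimately have "set_integrable lborel ?R (\<lambda>p. f (fst p) * g (snd p))"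
    by (rule set_integrable_subset) auto
  then have int: "integrable (lborel \<Otimes>\<^sub>M lborel) ?h"
    by (simp add: set_integrable_def lborel_prod)
  have "(LINT p:?R|lborel. f (fst p) * g (snd p)) = integral\<^sup>L (lborel \<Otimes>\<^sub>M lborel) ?h"
    by (simp add: set_lebesgue_integral_def lborel_prod)
  also have "\<dots> = (\<integral>s. (\<integral>t. ?h (s, t) \<partial>lborel) \<partial>lborel)"
    by (rule lborel_pair.integral_fst'[OF int, symmetric])
  also have "\<dots> = (\<integral>s. (\<integral>t. (indicator {a<..<b} s *\<^sub>R f s) * (indicator {c<..<d} t *\<^sub>R g t) \<partial>lborel) \<partial>lborel)"
    by (intro Bochner_Integration.integral_cong refl) (auto simp: indicator_def)
  also have "\<dots> = (LINT s:{a<..<b}|lborel. f s) * (LINT t:{c<..<d}|lborel. g t)"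
    by (simp only: set_lebesgue_integral_def integral_mult_right_zero integral_mult_left_zero)
  finally show ?thesis .
qed

lemma set_integral_open_interval_eq_integral:
  fixes f :: "real \<Rightarrow> complex"
  assumes "continuous_on {a..b} f"
  shows "(LINT s:{a<..<b}|lborel. f s) = integral {a..b} f"
proof -
  have "set_integrable lborel {a..b} f"
    unfolding set_integrable_def by (intro borel_integrable_compact assms) auto
  then have "set_integrable lborel {a<..<b} f"
    by (rule set_integrable_subset) auto
  then show ?thesis
    by (simp add: set_borel_integral_eq_integral(2) integral_open_interval_real)
qed

text \<open>
  For \<open>k \<noteq> 0\<close> this holds because the kernel \<open>exp (- k \<bar>x - s\<bar>)\<close> is, up to the factor \<open>2 k\<close>,
  the Green function of \<open>k\<^sup>2 - d\<^sup>2/dx\<^sup>2\<close> on \<open>[-a, a]\<close> with these Robin boundary conditions, and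
  \<open>(k\<^sup>2 - d\<^sup>2/dx\<^sup>2) u = (k\<^sup>2 - m\<^sup>2) u\<close>. The proof uses explicit antiderivatives on either side
  of \<open>x\<close>, which also covers \<open>k = 0\<close>.
\<close>

lemma set_integral_exp_kernel:
  fixes u v :: "real \<Rightarrow> complex" and k m :: complex
  assumes u: "\<And>s. (u has_vector_derivative v s) (at s)"
    and v: "\<And>s. (v has_vector_derivative m\<^sup>2 * u s) (at s)"
    and right: "k * u a + v a = 0" and left: "k * u (-a) - v (-a) = 0"
    and x: "x \<in> {-a..a}"
  shows "(k\<^sup>2 - m\<^sup>2) * (LINT s:{-a<..<a}|lborel. exp (- k * of_real \<bar>x - s\<bar>) * u s) = 2 * k * u x"
proof -
  let ?f = "\<lambda>s. exp (- k * of_real \<bar>x - s\<bar>) * u s"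
  have "continuous_on A u" for A
    using u by (meson continuous_at_imp_continuous_on has_vector_derivative_continuous)
  then have cont: "continuous_on A ?f" for A
    by (intro continuous_intros)
  have exp_left: "((\<lambda>s. exp (- k * of_real (x - s))) has_vector_derivative
      k * exp (- k * of_real (x - s))) (at s within A)" for s A
    by (auto intro!: derivative_eq_intros has_vector_derivative_real_field)
  have exp_right: "((\<lambda>s. exp (- k * of_real (s - x))) has_vector_derivative
      - k * exp (- k * of_real (s - x))) (at s within A)" for s A
    by (auto intro!: derivative_eq_intros has_vector_derivative_real_field)
  have u': "(u has_vector_derivative v s) (at s within A)"
    and v': "(v has_vector_derivative m\<^sup>2 * u s) (at s within A)" for s A
    using u v has_vector_derivative_at_within by blast+
  have L: "((\<lambda>s. (k\<^sup>2 - m\<^sup>2) * ?f s) has_integral (k * u x - v x)) {-a..x}"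
  proof -
    let ?F = "\<lambda>s. exp (- k * of_real (x - s)) * (k * u s - v s)"
    have "((\<lambda>s. (k\<^sup>2 - m\<^sup>2) * ?f s) has_integral (?F x - ?F (-a))) {-a..x}"
    proof (rule fundamental_theorem_of_calculus)
      fix s assume s: "s \<in> {-a..x}"
      have "(?F has_vector_derivative exp (- k * of_real (x - s)) * (k * v s - m\<^sup>2 * u s)
          + k * exp (- k * of_real (x - s)) * (k * u s - v s)) (at s within {-a..x})"
        by (intro has_vector_derivative_mult has_vector_derivative_diff exp_left u' v'
            has_vector_derivative_mult_right)
      then show "(?F has_vector_derivative (k\<^sup>2 - m\<^sup>2) * ?f s) (at s within {-a..x})"
        using s by (simp add: algebra_simps power2_eq_square)
    qed (use x in auto)
    then show ?thesis using left by simp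
  qed
  have R: "((\<lambda>s. (k\<^sup>2 - m\<^sup>2) * ?f s) has_integral (k * u x + v x)) {x..a}"
  proof -
    let ?F = "\<lambda>s. - (exp (- k * of_real (s - x)) * (k * u s + v s))"
    have "((\<lambda>s. (k\<^sup>2 - m\<^sup>2) * ?f s) has_integral (?F a - ?F x)) {x..a}"
    proof (rule fundamental_theorem_of_calculus)
      fix s assume s: "s \<in> {x..a}"
      have "(?F has_vector_derivative - (exp (- k * of_real (s - x)) * (k * v s + m\<^sup>2 * u s)
          + - k * exp (- k * of_real (s - x)) * (k * u s + v s))) (at s within {x..a})"
        by (intro has_vector_derivative_minus has_vector_derivative_mult
            has_vector_derivative_add exp_right u' v' has_vector_derivative_mult_right)
      then show "(?F has_vector_derivative (k\<^sup>2 - m\<^sup>2) * ?f s) (at s within {x..a})"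
        using s by (simp add: algebra_simps power2_eq_square)
    qed (use x in auto)
    then show ?thesis using right by (simp add: add.commute)
  qed
  have "((\<lambda>s. (k\<^sup>2 - m\<^sup>2) * ?f s) has_integral 2 * k * u x) {-a..a}"
    using has_integral_combine[OF _ _ L R] x by (simp add: algebra_simps)
  then have "integral {-a..a} (\<lambda>s. (k\<^sup>2 - m\<^sup>2) * ?f s) = 2 * k * u x"
    by (rule integral_unique)
  then show ?thesis
    by (simp only: set_integral_open_interval_eq_integral[OF cont] integral_mult_right)
qed

lemma cosh_has_vector_derivative:
  fixes m :: complex
  shows "((\<lambda>s. cosh (m * of_real s)) has_vector_derivative m * sinh (m * of_real s)) (at s)"
  by (auto intro!: derivative_eq_intros has_vector_derivative_real_field)

lemma sinh_has_vector_derivative: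
  fixes m :: complex
  shows "((\<lambda>s. sinh (m * of_real s)) has_vector_derivative m * cosh (m * of_real s)) (at s)"
  by (auto intro!: derivative_eq_intros has_vector_derivative_real_field)

text \<open>
  All that the argument uses about one factor of an eigenvector. In this form the four
  combinations of \<open>cosh\<close> and \<open>sinh\<close> are instances of one statement.
\<close>

definition kernel_eigenfunction :: "real \<Rightarrow> complex \<Rightarrow> complex \<Rightarrow> (real \<Rightarrow> complex) \<Rightarrow> bool" where
  "kernel_eigenfunction a k m u \<longleftrightarrow>
     continuous_on {-a..a} u \<and> u a \<noteq> 0 \<and>
     (\<forall>x\<in>{-a..a}. (k\<^sup>2 - m\<^sup>2) *
        (LINT s:{-a<..<a}|lborel. exp (- k * of_real \<bar>x - s\<bar>) * u s) = 2 * k * u x)"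

text \<open>
  If \<open>cosh (m a)\<close> vanished, the boundary equation would make \<open>sinh (m a)\<close> vanish as well, which
  contradicts \<open>cosh\<^sup>2 - sinh\<^sup>2 = 1\<close>. The boundary condition at \<open>-a\<close> follows from the one at \<open>a\<close> by
  parity. Both remarks apply to \<open>sinh\<close> too.
\<close>

lemma kernel_eigenfunction_cosh:
  assumes "m \<noteq> 0" and bc: "k * cosh (m * of_real a) + m * sinh (m * of_real a) = 0"
  shows "kernel_eigenfunction a k m (\<lambda>s. cosh (m * of_real s))"
  unfolding kernel_eigenfunction_def
proof (intro conjI ballI)
  show "continuous_on {-a..a} (\<lambda>s. cosh (m * of_real s))"
    by (intro continuous_at_imp_continuous_on ballI
        has_vector_derivative_continuous[OF cosh_has_vector_derivative])
  show "cosh (m * of_real a) \<noteq> 0"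
    using assms hyperbolic_pythagoras[of "m * of_real a"] by auto
  show "(k\<^sup>2 - m\<^sup>2) * (LINT s:{-a<..<a}|lborel. exp (- k * of_real \<bar>x - s\<bar>) * cosh (m * of_real s))
      = 2 * k * cosh (m * of_real x)" if "x \<in> {-a..a}" for x
  proof (rule set_integral_exp_kernel[OF cosh_has_vector_derivative _ bc _ that])
    show "((\<lambda>s. m * sinh (m * of_real s)) has_vector_derivative m\<^sup>2 * cosh (m * of_real s)) (at s)" for s
      using has_vector_derivative_mult_right[OF sinh_has_vector_derivative, of m m]
      by (simp add: power2_eq_square mult.assoc)
  qed (use bc in simp)
qed

lemma kernel_eigenfunction_sinh:
  assumes "m \<noteq> 0" and bc: "k * sinh (m * of_real a) + m * cosh (m * of_real a) = 0"
  shows "kernel_eigenfunction a k m (\<lambda>s. sinh (m * of_real s))"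
  unfolding kernel_eigenfunction_def
proof (intro conjI ballI)
  show "continuous_on {-a..a} (\<lambda>s. sinh (m * of_real s))"
    by (intro continuous_at_imp_continuous_on ballI
        has_vector_derivative_continuous[OF sinh_has_vector_derivative])
  show "sinh (m * of_real a) \<noteq> 0"
    using assms hyperbolic_pythagoras[of "m * of_real a"] by auto
  show "(k\<^sup>2 - m\<^sup>2) * (LINT s:{-a<..<a}|lborel. exp (- k * of_real \<bar>x - s\<bar>) * sinh (m * of_real s))
      = 2 * k * sinh (m * of_real x)" if "x \<in> {-a..a}" for x
  proof (rule set_integral_exp_kernel[OF sinh_has_vector_derivative _ bc _ that])
    show "((\<lambda>s. m * cosh (m * of_real s)) has_vector_derivative m\<^sup>2 * sinh (m * of_real s)) (at s)" for s
      using has_vector_derivative_mult_right[OF cosh_has_vector_derivative, of m m]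
      by (simp add: power2_eq_square mult.assoc)
    show "k * sinh (m * of_real (-a)) - m * cosh (m * of_real (-a)) = 0"
    proof -
      have "k * sinh (m * of_real (-a)) - m * cosh (m * of_real (-a))
          = - (k * sinh (m * of_real a) + m * cosh (m * of_real a))"
        by simp
      then show ?thesis by (simp only: bc minus_zero)
    qed
  qed
qed

lemma eigenvalue_with_eigenvector_product:
  assumes "a > 0" and "b > 0" and "dS0 \<noteq> 0" and "chat \<noteq> 0" and k: "k_fun xi z \<noteq> 0"
    and P: "P_char alpha tau0 dS0 chat xi z \<rho> \<nu> = 0"
    and u: "kernel_eigenfunction a (k_fun xi z) \<rho> u"
    and w: "kernel_eigenfunction b (k_fun xi z) \<nu> w"
  shows "eigenvalue_with_eigenvector a b alpha tau0 dS0 chat xi z (\<lambda>(x, y). u x * w y)"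
proof -
  define k where "k = k_fun xi z"
  define c where "c = c_fun tau0 dS0 chat z"
  have u_cont: "continuous_on {-a..a} u" and w_cont: "continuous_on {-b..b} w"
    using u w by (auto simp: kernel_eigenfunction_def)
  have q_cont: "continuous_on (Omega_bar a b) (\<lambda>(x, y). u x * w y)"
    unfolding Omega_bar_def split_beta
    by (intro continuous_on_mult continuous_on_compose2[OF u_cont] continuous_on_compose2[OF w_cont]
          continuous_on_fst continuous_on_snd continuous_on_id) auto
  have Omega: "Omega a b = {-a<..<a} \<times> {-b<..<b}"
    by (simp add: Omega_def Omega_bar_def interior_Times)
  have eq: "(z + of_real alpha) * ((k\<^sup>2 - \<rho>\<^sup>2) * (k\<^sup>2 - \<nu>\<^sup>2)) = 4 * c * k\<^sup>2"
    using P by (simp add: P_char_def k_def c_def algebra_simps)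
  moreover have "c \<noteq> 0" "k \<noteq> 0"
    using assms by (simp_all add: c_def c_fun_def k_def)
  ultimately have nz: "(k\<^sup>2 - \<rho>\<^sup>2) * (k\<^sup>2 - \<nu>\<^sup>2) \<noteq> 0"
    by auto
  have "Delta a b alpha tau0 dS0 chat xi z (\<lambda>(x, y). u x * w y) (x, y) = 0"
    if x: "x \<in> {-a..a}" and y: "y \<in> {-b..b}" for x y
  proof -
    let ?I = "LINT s:{-a<..<a}|lborel. exp (- k * of_real \<bar>x - s\<bar>) * u s"
    let ?K = "LINT t:{-b<..<b}|lborel. exp (- k * of_real \<bar>y - t\<bar>) * w t"
    let ?D = "LINT r':Omega a b|lborel.
      exp (- k * of_real (norm1 ((x, y) - r'))) * (case r' of (x, y) \<Rightarrow> u x * w y)"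
    have "?D = (LINT p:{-a<..<a} \<times> {-b<..<b}|lborel.
        (exp (- k * of_real \<bar>x - fst p\<bar>) * u (fst p)) * (exp (- k * of_real \<bar>y - snd p\<bar>) * w (snd p)))"
    proof -
      have "exp (- k * of_real (norm1 ((x, y) - p)))
          = exp (- k * of_real \<bar>x - fst p\<bar>) * exp (- k * of_real \<bar>y - snd p\<bar>)" for p
        by (simp only: norm1_def fst_diff snd_diff fst_conv snd_conv of_real_add distrib_left exp_add)
      then show ?thesis
        by (simp only: Omega split_beta mult_ac)
    qed
    also have "\<dots> = ?I * ?K"
      by (intro set_integral_open_rectangle_product continuous_intros u_cont w_cont)
    finally have D: "?D = ?I * ?K" .
    have "(k\<^sup>2 - \<rho>\<^sup>2) * ?I = 2 * k * u x" "(k\<^sup>2 - \<nu>\<^sup>2) * ?K = 2 * k * w y"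
      using u w x y by (auto simp: kernel_eigenfunction_def k_def)
    then have "((k\<^sup>2 - \<rho>\<^sup>2) * ?I) * ((k\<^sup>2 - \<nu>\<^sup>2) * ?K) = (2 * k * u x) * (2 * k * w y)"
      by (simp only:)
    then have XD: "((k\<^sup>2 - \<rho>\<^sup>2) * (k\<^sup>2 - \<nu>\<^sup>2)) * ?D = 4 * k\<^sup>2 * (u x * w y)"
      unfolding D by (simp add: power2_eq_square mult_ac)
    have "X * (A * U - C * V) = (A * X) * U - C * (X * V)" for X A U C V :: complex
      by (simp add: algebra_simps)
    then have "((k\<^sup>2 - \<rho>\<^sup>2) * (k\<^sup>2 - \<nu>\<^sup>2)) * ((z + of_real alpha) * (u x * w y) - c * ?D)
        = ((z + of_real alpha) * ((k\<^sup>2 - \<rho>\<^sup>2) * (k\<^sup>2 - \<nu>\<^sup>2))) * (u x * w y)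
          - c * (((k\<^sup>2 - \<rho>\<^sup>2) * (k\<^sup>2 - \<nu>\<^sup>2)) * ?D)"
      by blast
    also have "\<dots> = 0"
      unfolding eq XD by simp
    finally show ?thesis
      using nz by (simp add: Delta_def k_def c_def)
  qed
  then have "\<forall>r\<in>Omega_bar a b. Delta a b alpha tau0 dS0 chat xi z (\<lambda>(x, y). u x * w y) r = 0"
    by (auto simp: Omega_bar_def)
  \<comment> \<open>The corner \<open>(a, b)\<close> shows that the eigenvector is not the zero function.\<close>
  moreover have "(a, b) \<in> Omega_bar a b" "(case (a, b) of (x, y) \<Rightarrow> u x * w y) \<noteq> 0"
    using assms(1,2) u w by (auto simp: Omega_bar_def kernel_eigenfunction_def)
  ultimately show ?thesis
    using q_cont unfolding eigenvalue_with_eigenvector_def Y_space_def by blast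
qed

theorem theorem4p3:
  fixes a b alpha tau0 dS0 :: real and chat xi z \<rho> \<nu> :: complex
  assumes "a > 0" and "b > 0" and "alpha > 0" and "tau0 > 0" and "dS0 \<noteq> 0" and "chat \<noteq> 0"
    and J_real: "\<forall>r\<in>Omega_bar a b. \<forall>r'\<in>Omega_bar a b. J_ker chat xi r r' \<in> \<real>"
    and "z \<noteq> - of_real alpha" and "k_fun xi z \<noteq> 0"
    and "\<rho> \<noteq> 0" and "\<nu> \<noteq> 0"
    and "P_char alpha tau0 dS0 chat xi z \<rho> \<nu> = 0"
  shows
    "(k_fun xi z * cosh (\<rho> * of_real a) + \<rho> * sinh (\<rho> * of_real a) = 0 \<and>
      k_fun xi z * cosh (\<nu> * of_real b) + \<nu> * sinh (\<nu> * of_real b) = 0 \<longrightarrow>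
        eigenvalue_with_eigenvector a b alpha tau0 dS0 chat xi z
          (\<lambda>(x, y). cosh (\<rho> * of_real x) * cosh (\<nu> * of_real y)))
     \<and>
     (k_fun xi z * sinh (\<rho> * of_real a) + \<rho> * cosh (\<rho> * of_real a) = 0 \<and>
      k_fun xi z * cosh (\<nu> * of_real b) + \<nu> * sinh (\<nu> * of_real b) = 0 \<longrightarrow>
        eigenvalue_with_eigenvector a b alpha tau0 dS0 chat xi z
          (\<lambda>(x, y). sinh (\<rho> * of_real x) * cosh (\<nu> * of_real y)))
     \<and>
     (k_fun xi z * cosh (\<rho> * of_real a) + \<rho> * sinh (\<rho> * of_real a) = 0 \<and>
      k_fun xi z * sinh (\<nu> * of_real b) + \<nu> * cosh (\<nu> * of_real b) = 0 \<longrightarrow>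
        eigenvalue_with_eigenvector a b alpha tau0 dS0 chat xi z
          (\<lambda>(x, y). cosh (\<rho> * of_real x) * sinh (\<nu> * of_real y)))
     \<and>
     (k_fun xi z * sinh (\<rho> * of_real a) + \<rho> * cosh (\<rho> * of_real a) = 0 \<and>
      k_fun xi z * sinh (\<nu> * of_real b) + \<nu> * cosh (\<nu> * of_real b) = 0 \<longrightarrow>
        eigenvalue_with_eigenvector a b alpha tau0 dS0 chat xi z
          (\<lambda>(x, y). sinh (\<rho> * of_real x) * sinh (\<nu> * of_real y)))"
proof (intro conjI impI; elim conjE)
  note product = eigenvalue_with_eigenvector_product[OF assms(1,2,5,6,9,12)]
  {
    assume "k_fun xi z * cosh (\<rho> * of_real a) + \<rho> * sinh (\<rho> * of_real a) = 0"
      and "k_fun xi z * cosh (\<nu> * of_real b) + \<nu> * sinh (\<nu> * of_real b) = 0"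
    then show "eigenvalue_with_eigenvector a b alpha tau0 dS0 chat xi z
        (\<lambda>(x, y). cosh (\<rho> * of_real x) * cosh (\<nu> * of_real y))"
      by (intro product kernel_eigenfunction_cosh assms(10,11))
  next
    assume "k_fun xi z * sinh (\<rho> * of_real a) + \<rho> * cosh (\<rho> * of_real a) = 0"
      and "k_fun xi z * cosh (\<nu> * of_real b) + \<nu> * sinh (\<nu> * of_real b) = 0"
    then show "eigenvalue_with_eigenvector a b alpha tau0 dS0 chat xi z
        (\<lambda>(x, y). sinh (\<rho> * of_real x) * cosh (\<nu> * of_real y))"
      by (intro product kernel_eigenfunction_sinh kernel_eigenfunction_cosh assms(10,11))
  next
    assume "k_fun xi z * cosh (\<rho> * of_real a) + \<rho> * sinh (\<rho> * of_real a) = 0"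
      and "k_fun xi z * sinh (\<nu> * of_real b) + \<nu> * cosh (\<nu> * of_real b) = 0"
    then show "eigenvalue_with_eigenvector a b alpha tau0 dS0 chat xi z
        (\<lambda>(x, y). cosh (\<rho> * of_real x) * sinh (\<nu> * of_real y))"
      by (intro product kernel_eigenfunction_sinh kernel_eigenfunction_cosh assms(10,11))
  next
    assume "k_fun xi z * sinh (\<rho> * of_real a) + \<rho> * cosh (\<rho> * of_real a) = 0"
      and "k_fun xi z * sinh (\<nu> * of_real b) + \<nu> * cosh (\<nu> * of_real b) = 0"
    then show "eigenvalue_with_eigenvector a b alpha tau0 dS0 chat xi z
        (\<lambda>(x, y). sinh (\<rho> * of_real x) * sinh (\<nu> * of_real y))"
      by (intro product kernel_eigenfunction_sinh assms(10,11))
  }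
qed

end
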